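(* Let $n>1$ be an even integer and let $k\in\mathbb{Z}$. Then the polynomial $$f_{n,k}(x)=k\sum_{j\geq 0}\binom{n-1}{2j+1}(x^j-x^{j+1})+2\sum_{j\geq 0}\binom{n}{2j}x^j\in\mathbb{Z}[x]$$ is self-reciprocal if and only if $k\in\{0,2\}$.
   Context: Binomial coefficients $\binom{a}{b}$ are $0$ when $b>a$, so the sums are finite. A nonzero polynomial $f(x)$ of (actual) degree $d\ge 0$ is called self-reciprocal if $x^d f(1/x)=f(x)$, i.e. if $f(x)=\sum_{i=0}^d a_ix^i$ with $a_d\neq 0$ then $a_i=a_{d-i}$ for all $0\le i\le d$. Nonzero constant polynomials (degree $0$) count as self-reciprocal. *)

theory Defs
  imports "HOL-Computational_Algebra.Polynomial"
begin

definition self_reciprocal :: "'a::zero poly \<Rightarrow> bool" where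
  "self_reciprocal f \<longleftrightarrow>
     f \<noteq> 0 \<and> (\<forall>i\<le>degree f. coeff f i = coeff f (degree f - i))"

(* reflect_poly f is x^d f(1/x) for d = degree f. *)
lemma self_reciprocal_iff_reflect_poly:
  "self_reciprocal f \<longleftrightarrow> f \<noteq> 0 \<and> reflect_poly f = f"
proof -
  have "(\<forall>i\<le>degree f. coeff f i = coeff f (degree f - i)) \<longleftrightarrow>
        (\<forall>i. coeff (reflect_poly f) i = coeff f i)"
  proof (intro iffI allI impI)
    fix i
    assume H: "\<forall>i\<le>degree f. coeff f i = coeff f (degree f - i)"
    show "coeff (reflect_poly f) i = coeff f i"
    proof (cases "i \<le> degree f")
      case True
      with H have "coeff f i = coeff f (degree f - i)" by blast
      with True show ?thesis by (simp only: coeff_reflect_poly not_less[symmetric] if_False)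
    next
      case False
      then have "degree f < i" by (rule not_le_imp_less)
      then show ?thesis by (simp only: coeff_reflect_poly coeff_eq_0 if_True)
    qed
  next
    fix i
    assume H: "\<forall>i. coeff (reflect_poly f) i = coeff f i" and "i \<le> degree f"
    from H have "coeff (reflect_poly f) i = coeff f i" by blast
    with \<open>i \<le> degree f\<close> show "coeff f i = coeff f (degree f - i)"
      by (simp only: coeff_reflect_poly not_less[symmetric] if_False)
  qed
  then show ?thesis
    unfolding self_reciprocal_def poly_eq_iff[of "reflect_poly f"] by blast
qed

(* The sums over all j >= 0 are cut off at j = n: for j > n both 2j+1 > n-1 and
   2j > n, so the binomial coefficients of all omitted terms vanish. *)
definition f_poly :: "nat \<Rightarrow> int \<Rightarrow> int poly" where
  "f_poly n k =
     smult k (\<Sum>j\<le>n. smult (of_nat ((n - 1) choose (2 * j + 1)))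
                              (monom 1 j - monom 1 (j + 1)))
     + smult 2 (\<Sum>j\<le>n. smult (of_nat (n choose (2 * j))) (monom 1 j))"

end

(* By Pascal's rule the coefficient of x^i in f_{n,k} is k C(n,2i+1) + (2-k) C(n,2i). For n = 2m
   this is symmetric under i -> m-i when k = 0 and under i -> m-1-i when k = 2. For k different from 2 the
   degree is m, the leading coefficient is 2-k and the constant one is k(n-1)+2; they agree only
   if kn = 0. *)

theory Submission
  imports Defs
begin

text \<open>With \<open>p = n - 1\<close>, multiplying by \<open>1 - x\<close> turns the odd-indexed
  coefficients into C(p,2i+1) - C(p,2i-1). Pascal's rule, applied once to C(n,2i) and once to
  C(n,2i+1), rewrites everything in row \<open>n\<close>.\<close>

lemma coeff_f_poly:
  assumes "n > 0"
  shows "coeff (f_poly n k) i =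
    k * int (n choose (2 * i + 1)) + (2 - k) * int (n choose (2 * i))"
proof -
  obtain p where n: "n = Suc p" using assms gr0_implies_Suc by blast
  have even_part:
      "coeff (\<Sum>j\<le>n. smult (int (n choose (2 * j))) (monom 1 j)) i = int (n choose (2 * i))"
    by (auto simp: coeff_sum if_distrib cong: if_cong)
  have "coeff (\<Sum>j\<le>n. smult (int (p choose (2 * j + 1))) (monom 1 j - monom 1 (j + 1))) i
      = (\<Sum>j\<le>n. if j = i then int (p choose (2 * j + 1)) else 0)
        - (\<Sum>j\<le>n. if j + 1 = i then int (p choose (2 * j + 1)) else 0)"
    unfolding coeff_sum sum_subtractf[symmetric] by (intro sum.cong) auto
  also have "(\<Sum>j\<le>n. if j = i then int (p choose (2 * j + 1)) else 0) = int (p choose (2 * i + 1))"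
    by (auto simp: n)
  \<comment> \<open>The sum picks out C(p,2i-1), written as a difference by Pascal's rule. This form
    also covers \<open>i = 0\<close>, where the sum is empty and both binomials are 1.\<close>
  also have "(\<Sum>j\<le>n. if j + 1 = i then int (p choose (2 * j + 1)) else 0)
      = int (n choose (2 * i)) - int (p choose (2 * i))"
    by (cases i) (auto simp: n)
  finally have odd_part:
      "coeff (\<Sum>j\<le>n. smult (int (p choose (2 * j + 1))) (monom 1 j - monom 1 (j + 1))) i
        = int (p choose (2 * i + 1)) - (int (n choose (2 * i)) - int (p choose (2 * i)))" .
  have p: "n - 1 = p" and "int (n choose (2 * i + 1)) = int (p choose (2 * i)) + int (p choose (2 * i + 1))"
    by (simp_all add: n)
  then show ?thesis
    unfolding f_poly_def coeff_add coeff_smult p odd_part even_part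
    by (simp only: algebra_simps)
qed

lemma degree_eqI:
  assumes "coeff p d \<noteq> 0" and "\<And>i. i > d \<Longrightarrow> coeff p i = 0"
  shows "degree p = d"
  using assms by (meson degree_le le_antisym le_degree)

theorem theorem2p1:
  fixes n :: nat and k :: int
  assumes "n > 1" and "even n"
  shows "self_reciprocal (f_poly n k) \<longleftrightarrow> k \<in> {0, 2}"
proof -
  obtain m where n: "n = 2 * m" using assms(2) by blast
  have m: "m > 0" using assms(1) n by simp
  have c: "coeff (f_poly n k) i =
    k * int (n choose (2 * i + 1)) + (2 - k) * int (n choose (2 * i))" for i
    using coeff_f_poly assms(1) by simp
  show ?thesis
  proof (cases "k = 2")
    case True
    have c2: "coeff (f_poly n k) i = 2 * int (n choose (2 * i + 1))" for i
      unfolding c by (simp add: True)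
    \<comment> \<open>Here 2(m-1)+1 = n-1, so the coefficient is 2n.\<close>
    have lead: "coeff (f_poly n k) (m - 1) \<noteq> 0"
      unfolding c2 using m by (simp add: n)
    have deg: "degree (f_poly n k) = m - 1"
      using lead by (rule degree_eqI) (unfold c2, simp add: n)
    \<comment> \<open>As \<open>n\<close> is even, complementation in \<open>n\<close> preserves odd
      lower indices, and it acts on \<open>i\<close> as reflection about (m-1)/2.\<close>
    have "n choose (2 * (m - 1 - i) + 1) = n choose (2 * i + 1)" if "i \<le> m - 1" for i
    proof -
      have "2 * (m - 1 - i) + 1 = n - (2 * i + 1)" using that m n by simp
      then show ?thesis
        using binomial_symmetric[of "2 * i + 1" n] that m n by simp
    qed
    moreover have "f_poly n k \<noteq> 0" using lead by auto
    ultimately have "self_reciprocal (f_poly n k)"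
      unfolding self_reciprocal_def deg c2 by simp
    then show ?thesis using True by simp
  next
    case False
    \<comment> \<open>The odd index 2m+1 exceeds \<open>n\<close>, so only C(n,n) = 1
      survives.\<close>
    have lead: "coeff (f_poly n k) m = 2 - k"
      unfolding c by (simp add: n)
    have deg: "degree (f_poly n k) = m"
    proof (rule degree_eqI)
      show "coeff (f_poly n k) m \<noteq> 0" using False lead by simp
      show "coeff (f_poly n k) i = 0" if "i > m" for i
        unfolding c using that by (simp add: n binomial_eq_0)
    qed
    have "k = 0" if "self_reciprocal (f_poly n k)"
    proof -
      \<comment> \<open>Comparing the two end coefficients suffices: kn + (2-k) = 2-k forces kn =
        0.\<close>
      have "coeff (f_poly n k) 0 = coeff (f_poly n k) m"
        using that unfolding self_reciprocal_def deg by (metis diff_zero le0)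
      then have "k * int n = 0" unfolding lead unfolding c by simp
      then show ?thesis using assms(1) by simp
    qed
    moreover have "self_reciprocal (f_poly n k)" if "k = 0"
    proof -
      \<comment> \<open>Complementation in \<open>n\<close> sends the even index 2i to
        2(m-i).\<close>
      have "n choose (2 * (m - i)) = n choose (2 * i)" if "i \<le> m" for i
        using binomial_symmetric[of "2 * i" n] that n by (simp add: diff_mult_distrib2)
      moreover have "f_poly n k \<noteq> 0" using lead False by auto
      ultimately show ?thesis
        unfolding self_reciprocal_def deg c by (simp add: that)
    qed
    ultimately show ?thesis using False by blast
  qed
qed

end
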